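(* Let $D_{syn}$ and $D_{real}$ be probability distributions on $\mathcal{X}\times\mathcal{Y}$, and let $\ell:\mathcal{Y}\times\mathcal{Y}\to[0,L_{max}]$ be a bounded loss function. For a predictor $f:\mathcal{X}\to\mathcal{Y}$ put $R_{syn}(f)=\mathbb{E}_{(x,y)\sim D_{syn}}[\ell(f(x),y)]$ and $R_{real}(f)=\mathbb{E}_{(x,y)\sim D_{real}}[\ell(f(x),y)]$, and let $f^{\star}_{syn}$ and $f^{\star}_{real}$ be minimizers, over all measurable predictors, of $R_{syn}$ and $R_{real}$ respectively. Let $f_{\phi_N}$ be the empirical risk minimizer over the family $\{f_\phi:\phi\in\Phi\}$ on a training set $D_{syn}^{(N)}$ of $N$ i.i.d. samples from $D_{syn}$, and let $$\Delta_{TV}=\sup_{A\subseteq\mathcal{X}\times\mathcal{Y}}|D_{real}(A)-D_{syn}(A)|$$ (supremum over measurable sets $A$) be the total variation distance between $D_{real}$ and $D_{syn}$. Then $$R_{real}(f_{\phi_N})-R_{real}(f^{\star}_{real})\;\le\;R_{syn}(f_{\phi_N})-R_{syn}(f^{\star}_{syn})+2L_{max}\,\Delta_{TV}.$$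
   Context: $D_{syn}$ is the training distribution induced by a simulator and $D_{real}$ is the true data-generating distribution at test time. The predictor $f_{\phi_N}$ is given by $$\phi_N=\arg\min_{\phi\in\Phi}\frac1N\sum_{(x_i,y_i)\in D_{syn}^{(N)}}\ell(f_\phi(x_i),y_i).$$ Standing assumptions: the minimizers $\phi_N$, $f^{\star}_{syn}$, $f^{\star}_{real}$ exist; the family $\{f_\phi:\phi\in\Phi\}$ has universal approximation capacity, i.e. $\inf_{\phi\in\Phi}R_{syn}(f_\phi)=R_{syn}(f^{\star}_{syn})$; and $f_{\phi_N}$ is a consistent estimator of $f^{\star}_{syn}$, i.e. $R_{syn}(f_{\phi_N})\to R_{syn}(f^{\star}_{syn})$ almost surely as $N\to\infty$. For the data-dependent predictor $f_{\phi_N}$, the risks are computed over a fresh pair $(x,y)$ with $f_{\phi_N}$ held fixed, and the inequality holds for every realization of the training set. *)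

theory Defs
  imports "HOL-Probability.Probability"
begin

definition risk ::
  "('x \<times> 'y) measure \<Rightarrow> ('y \<Rightarrow> 'y \<Rightarrow> real) \<Rightarrow> ('x \<Rightarrow> 'y) \<Rightarrow> real" where
  "risk D l f = (\<integral>(x, y). l (f x) y \<partial>D)"

definition empirical_risk ::
  "nat \<Rightarrow> (nat \<Rightarrow> 'x \<times> 'y) \<Rightarrow> ('y \<Rightarrow> 'y \<Rightarrow> real) \<Rightarrow> ('x \<Rightarrow> 'y) \<Rightarrow> real" where
  "empirical_risk N S l f = 1 / real N * (\<Sum>i<N. case S i of (x, y) \<Rightarrow> l (f x) y)"

text \<open>
  The total variation distance without a factor 1/2. It is meant for probability measures
  \<open>M\<close>, \<open>M'\<close> with \<open>sets M = sets M'\<close>, for which the supremum is over a bounded set.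
\<close>

definition total_variation :: "'a measure \<Rightarrow> 'a measure \<Rightarrow> real" where
  "total_variation M M' = (SUP A\<in>sets M. \<bar>measure M A - measure M' A\<bar>)"

text \<open>
  The random variables \<open>Z 0, \<dots>, Z (N - 1)\<close> on the probability space \<open>P\<close> are
  independent and each has distribution \<open>D\<close>. Measurability of the \<open>Z i\<close> is part of
  \<^const>\<open>prob_space.indep_vars\<close>.
\<close>

definition iid_sample ::
  "'w measure \<Rightarrow> 'a measure \<Rightarrow> nat \<Rightarrow> (nat \<Rightarrow> 'w \<Rightarrow> 'a) \<Rightarrow> bool" where
  "iid_sample P D N Z \<longleftrightarrow>
     prob_space.indep_vars P (\<lambda>_. D) Z {..<N} \<and> (\<forall>i<N. distr P D (Z i) = D)"

end

theory Submission
  imports Defs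
begin

text \<open>
  A function with values in \<open>[0, L]\<close> is, up to \<open>L / n\<close>, the average of \<open>n\<close> functions that are
  \<open>L\<close> times the indicator of one of its superlevel sets, so its expectations under two probability
  measures differ by at most \<open>L\<close> times the total variation distance. This is applied to the losses
  of the empirical risk minimizer and of the optimal predictor for \<open>D_real\<close>; the remaining
  difference of risks under \<open>D_syn\<close> has the right sign because \<open>f_syn\<close> is optimal for \<open>D_syn\<close>.
\<close>

text \<open>A real-valued \<open>SUP\<close> dominates its members only if they are bounded above;
  for two probability measures the bound 1 serves.\<close>

lemma abs_measure_diff_le_total_variation:
  assumes "prob_space M" "prob_space M'" "A \<in> sets M"
  shows "\<bar>measure M A - measure M' A\<bar> \<le> total_variation M M'"
  unfolding total_variation_def
proof (rule cSUP_upper[OF assms(3)])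
  interpret M: prob_space M by fact
  interpret M': prob_space M' by fact
  have "\<bar>measure M B - measure M' B\<bar> \<le> 1" for B
    using M.prob_le_1[of B] M'.prob_le_1[of B] measure_nonneg[of M B] measure_nonneg[of M' B]
    by linarith
  then show "bdd_above ((\<lambda>A. \<bar>measure M A - measure M' A\<bar>) ` sets M)"
    by (intro bdd_aboveI2[where M = 1])
qed

lemma total_variation_commute:
  assumes "sets M = sets M'"
  shows "total_variation M M' = total_variation M' M"
  unfolding total_variation_def by (simp add: assms abs_minus_commute)

text \<open>Counting the positive integers up to \<open>t\<close> gives its floor. The count starts
  at 1 because 0 would always be included, and \<open>t \<le> real n\<close> ensures that the
  cut-off at \<open>n\<close> loses nothing.\<close>

lemma sum_of_bool_le_eq_floor:
  fixes t :: real
  assumes "0 \<le> t" "t \<le> real n"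
  shows "(\<Sum>k=1..n. of_bool (real k \<le> t) :: real) = of_int \<lfloor>t\<rfloor>"
proof -
  have "{1..n} \<inter> {k. real k \<le> t} = {1..nat \<lfloor>t\<rfloor>}"
  proof (intro set_eqI)
    fix k
    have "real k \<le> t \<longleftrightarrow> k \<le> nat \<lfloor>t\<rfloor>"
      using assms(1) by (simp add: le_nat_iff le_floor_iff)
    moreover have "nat \<lfloor>t\<rfloor> \<le> n"
      using assms by (simp add: nat_le_iff floor_le_iff)
    ultimately show "k \<in> {1..n} \<inter> {k. real k \<le> t} \<longleftrightarrow> k \<in> {1..nat \<lfloor>t\<rfloor>}"
      by auto
  qed
  then show ?thesis
    using assms by (simp add: of_bool_def sum.If_cases)
qed

text \<open>A discrete layer-cake argument: \<open>n * u\<close> is rounded down to a sum of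
  indicators, each of which changes its expectation by at most the total variation distance.\<close>

lemma integral_diff_le_total_variation_unit:
  fixes u :: "'a \<Rightarrow> real"
  assumes "prob_space M" "prob_space M'" and sets_eq: "sets M = sets M'"
    and meas: "u \<in> borel_measurable M"
    and bounded: "\<And>x. x \<in> space M \<Longrightarrow> u x \<in> {0..1}"
  shows "(\<integral>x. u x \<partial>M) - (\<integral>x. u x \<partial>M') \<le> total_variation M M'"
proof -
  interpret M: prob_space M by fact
  interpret M': prob_space M' by fact
  have space_eq: "space M' = space M"
    by (rule sets_eq_imp_space_eq[OF sets_eq, symmetric])
  have meas': "u \<in> borel_measurable M'"
    using meas measurable_cong_sets[OF sets_eq refl] by blast
  have int: "integrable M u"
    by (rule M.integrable_const_bound[where B = 1]) (use bounded meas in auto)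
  have int': "integrable M' u"
    by (rule M'.integrable_const_bound[where B = 1]) (use bounded meas' in \<open>auto simp: space_eq\<close>)
  \<comment> \<open>The rounding error 1 is independent of \<open>n\<close>, so it becomes
    negligible relative to \<open>n\<close>.\<close>
  have approx: "real n * ((\<integral>x. u x \<partial>M) - (\<integral>x. u x \<partial>M')) \<le> real n * total_variation M M' + 1"
    for n
  proof -
    \<comment> \<open>The superlevel set of \<open>u\<close> at height \<open>k / n\<close>, with
      the denominator cleared so that \<open>n = 0\<close> is no special case.\<close>
    define A where "A k = {x \<in> space M. real k \<le> real n * u x}" for k
    have A: "A k \<in> sets M" for k
      unfolding A_def using meas by measurable
    have A': "A k \<in> sets M'" for k
      using A sets_eq by simp
    define s where "s x = (\<Sum>k=1..n. indicator (A k) x :: real)" for x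
    have s: "s x = of_int \<lfloor>real n * u x\<rfloor>" if "x \<in> space M" for x
    proof -
      have "s x = (\<Sum>k=1..n. of_bool (real k \<le> real n * u x))"
        unfolding s_def using that by (intro sum.cong) (auto simp: A_def indicator_def)
      also have "\<dots> = of_int \<lfloor>real n * u x\<rfloor>"
        using bounded[OF that] by (intro sum_of_bool_le_eq_floor) (auto intro: mult_left_le)
      finally show ?thesis .
    qed
    have s_integral:
      "has_bochner_integral M s (\<Sum>k=1..n. measure M (A k))"
      "has_bochner_integral M' s (\<Sum>k=1..n. measure M' (A k))"
      unfolding s_def using A A'
      by (auto intro!: has_bochner_integral_sum has_bochner_integral_real_indicator
          simp: M.emeasure_finite M'.emeasure_finite less_top[symmetric])
    note int_s = s_integral[THEN has_bochner_integral_iff[THEN iffD1, THEN conjunct1]]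
      and integral_s = s_integral[THEN has_bochner_integral_integral_eq]
    have "real n * (\<integral>x. u x \<partial>M) = (\<integral>x. real n * u x \<partial>M)"
      by simp
    \<comment> \<open>Since \<open>s\<close> is the floor of \<open>n * u\<close>, it falls short by
      less than 1, and the constant 1 integrates to 1 under a probability measure.\<close>
    also have "\<dots> \<le> (\<integral>x. s x + 1 \<partial>M)"
      by (intro integral_mono) (use int int_s s in \<open>auto intro: less_imp_le\<close>)
    also have "\<dots> = (\<Sum>k=1..n. measure M (A k)) + 1"
      using int_s integral_s by (simp add: M.prob_space)
    finally have upper: "real n * (\<integral>x. u x \<partial>M) \<le> (\<Sum>k=1..n. measure M (A k)) + 1" .
    \<comment> \<open>Under \<open>M'\<close> a lower bound is wanted, and rounding down gives it
      without any error term.\<close>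
    have "(\<Sum>k=1..n. measure M' (A k)) = (\<integral>x. s x \<partial>M')"
      using integral_s by simp
    also have "\<dots> \<le> (\<integral>x. real n * u x \<partial>M')"
      by (intro integral_mono) (use int' int_s s space_eq in auto)
    finally have lower: "(\<Sum>k=1..n. measure M' (A k)) \<le> real n * (\<integral>x. u x \<partial>M')"
      by simp
    have "(\<Sum>k=1..n. measure M (A k)) - (\<Sum>k=1..n. measure M' (A k))
        = (\<Sum>k=1..n. measure M (A k) - measure M' (A k))"
      by (simp add: sum_subtractf)
    also have "\<dots> \<le> (\<Sum>k=1..n. total_variation M M')"
      by (rule sum_mono, rule abs_le_D1) (rule abs_measure_diff_le_total_variation[OF assms(1,2) A])
    also have "\<dots> = real n * total_variation M M'"
      by simp
    finally show ?thesis
      using upper lower unfolding right_diff_distrib by linarith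
  qed
  show ?thesis
  \<comment> \<open>A positive excess over the total variation distance, multiplied by a large
    enough \<open>n\<close>, would exceed the rounding error 1.\<close>
  proof (rule ccontr)
    assume "\<not> ?thesis"
    then have "0 < (\<integral>x. u x \<partial>M) - (\<integral>x. u x \<partial>M') - total_variation M M'"
      by simp
    then obtain n
      where "1 < real n * ((\<integral>x. u x \<partial>M) - (\<integral>x. u x \<partial>M') - total_variation M M')"
      using reals_Archimedean3 by blast
    with approx[of n] show False
      unfolding right_diff_distrib by linarith
  qed
qed

text \<open>Division by \<open>L\<close> reduces this to values in the unit interval;
  \<open>L = 0\<close> is treated apart, where \<open>h\<close> vanishes on the space.\<close>

lemma integral_diff_le_total_variation:
  fixes h :: "'a \<Rightarrow> real"
  assumes M: "prob_space M" "prob_space M'" "sets M = sets M'"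
    and meas: "h \<in> borel_measurable M"
    and bounded: "\<And>x. x \<in> space M \<Longrightarrow> h x \<in> {0..L}"
  shows "(\<integral>x. h x \<partial>M) - (\<integral>x. h x \<partial>M') \<le> L * total_variation M M'"
proof -
  interpret M: prob_space M by fact
  \<comment> \<open>A probability space is nonempty, so the range \<open>{0..L}\<close> contains a
    value of \<open>h\<close> and \<open>L\<close> cannot be negative.\<close>
  obtain x where "x \<in> space M"
    using M.not_empty by blast
  then have "0 \<le> L"
    using bounded by force
  show ?thesis
  proof (cases "L = 0")
    case True
    with bounded have h: "h x = 0" if "x \<in> space M" for x
      using that by force
    have "(\<integral>x. h x \<partial>M) = (\<integral>x. 0 \<partial>M)"
      by (rule Bochner_Integration.integral_cong[OF refl h])
    moreover have "(\<integral>x. h x \<partial>M') = (\<integral>x. 0 \<partial>M')"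
      by (rule Bochner_Integration.integral_cong[OF refl h])
        (simp add: sets_eq_imp_space_eq[OF M(3)])
    ultimately show ?thesis
      using True by simp
  next
    case False
    with \<open>0 \<le> L\<close> have L: "0 < L"
      by simp
    have "(\<integral>x. h x / L \<partial>M) - (\<integral>x. h x / L \<partial>M') \<le> total_variation M M'"
      by (rule integral_diff_le_total_variation_unit[OF M]) (use meas bounded L in auto)
    then show ?thesis
      using L by (simp add: diff_divide_distrib[symmetric] divide_le_eq mult.commute)
  qed
qed

text \<open>For a fixed predictor the loss is a measurable function of the pair with values in
  \<open>{0..L}\<close>, and the risk is its expectation. A trained predictor is covered once its
  training sample is fixed.\<close>

lemma risk_diff_le_total_variation:
  assumes D: "prob_space D" "sets D = sets (MX \<Otimes>\<^sub>M MY)"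
    and D': "prob_space D'" "sets D' = sets (MX \<Otimes>\<^sub>M MY)"
    and loss: "(\<lambda>(y, y'). l y y') \<in> borel_measurable (MY \<Otimes>\<^sub>M MY)"
      "\<And>y y'. y \<in> space MY \<Longrightarrow> y' \<in> space MY \<Longrightarrow> l y y' \<in> {0..L}"
    and g: "g \<in> measurable MX MY"
  shows "risk D l g - risk D' l g \<le> L * total_variation D D'"
  unfolding risk_def
proof (rule integral_diff_le_total_variation)
  have "(\<lambda>z. (\<lambda>(y, y'). l y y') (g (fst z), snd z)) \<in> borel_measurable (MX \<Otimes>\<^sub>M MY)"
    by (intro measurable_compose[OF _ loss(1)] measurable_Pair measurable_compose[OF _ g]
        measurable_fst measurable_snd)
  then show "(\<lambda>(x, y). l (g x) y) \<in> borel_measurable D"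
    by (simp add: case_prod_beta measurable_cong_sets[OF D(2) refl])
  show "(case z of (x, y) \<Rightarrow> l (g x) y) \<in> {0..L}" if "z \<in> space D" for z
    using that loss(2) measurable_space[OF g] sets_eq_imp_space_eq[OF D(2)]
    by (auto simp: space_pair_measure split: prod.split)
qed (use D D' in auto)

theorem theorem2:
  fixes MX :: "'x measure" and MY :: "'y measure"
    and D_syn D_real :: "('x \<times> 'y) measure"
    and l :: "'y \<Rightarrow> 'y \<Rightarrow> real" and L_max :: real
    and \<Phi> :: "'p set" and f :: "'p \<Rightarrow> 'x \<Rightarrow> 'y"
    and f_syn f_real :: "'x \<Rightarrow> 'y"
    and P :: "'w measure" and Z :: "nat \<Rightarrow> nat \<Rightarrow> 'w \<Rightarrow> 'x \<times> 'y"
    and \<phi> :: "nat \<Rightarrow> 'w \<Rightarrow> 'p"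
    and N :: nat and \<omega> :: 'w
  assumes D_syn: "prob_space D_syn" "sets D_syn = sets (MX \<Otimes>\<^sub>M MY)"
    and D_real: "prob_space D_real" "sets D_real = sets (MX \<Otimes>\<^sub>M MY)"
    and loss_measurable: "(\<lambda>(y, y'). l y y') \<in> borel_measurable (MY \<Otimes>\<^sub>M MY)"
    and loss_bounded: "\<And>y y'. y \<in> space MY \<Longrightarrow> y' \<in> space MY \<Longrightarrow> l y y' \<in> {0..L_max}"
    and f_syn: "is_arg_min (risk D_syn l) (\<lambda>g. g \<in> measurable MX MY) f_syn"
    and f_real: "is_arg_min (risk D_real l) (\<lambda>g. g \<in> measurable MX MY) f_real"
    and family: "\<And>p. p \<in> \<Phi> \<Longrightarrow> f p \<in> measurable MX MY"
    and training: "prob_space P" "\<And>n. iid_sample P D_syn n (Z n)"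
    and erm: "\<And>n w. 0 < n \<Longrightarrow> w \<in> space P \<Longrightarrow>
      is_arg_min (\<lambda>p. empirical_risk n (\<lambda>i. Z n i w) l (f p)) (\<lambda>p. p \<in> \<Phi>) (\<phi> n w)"
    and universal: "(INF p\<in>\<Phi>. risk D_syn l (f p)) = risk D_syn l f_syn"
    and consistent: "AE w in P. (\<lambda>n. risk D_syn l (f (\<phi> n w))) \<longlonglongrightarrow> risk D_syn l f_syn"
    and N: "0 < N" and \<omega>: "\<omega> \<in> space P"
  shows "risk D_real l (f (\<phi> N \<omega>)) - risk D_real l f_real
    \<le> risk D_syn l (f (\<phi> N \<omega>)) - risk D_syn l f_syn + 2 * L_max * total_variation D_real D_syn"
proof -
  have minimizer: "\<phi> N \<omega> \<in> \<Phi>"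
    using erm[OF N \<omega>] by (simp add: is_arg_min_def)
  have f_real_meas: "f_real \<in> measurable MX MY"
    using f_real by (simp add: is_arg_min_def)
  have "risk D_real l (f (\<phi> N \<omega>)) - risk D_syn l (f (\<phi> N \<omega>))
      \<le> L_max * total_variation D_real D_syn"
    by (rule risk_diff_le_total_variation[OF D_real D_syn loss_measurable loss_bounded
          family[OF minimizer]])
  \<comment> \<open>A second change of distribution, now in the opposite direction, which accounts
    for the factor 2; symmetry of the total variation distance restores the order of its
    arguments.\<close>
  moreover have "risk D_syn l f_real - risk D_real l f_real
      \<le> L_max * total_variation D_real D_syn"
    using risk_diff_le_total_variation[OF D_syn D_real loss_measurable loss_bounded f_real_meas]
      total_variation_commute[of D_real D_syn] D_syn(2) D_real(2) by simp
  \<comment> \<open>\<open>f_real\<close> is itself a measurable predictor, hence a competitor of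
    \<open>f_syn\<close>.\<close>
  moreover have "risk D_syn l f_syn \<le> risk D_syn l f_real"
    using f_syn f_real_meas by (auto simp: is_arg_min_def not_less)
  ultimately show ?thesis
    by linarith
qed

end
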